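(* Let $\Pi$ be a Gibbs partition with parameters $(\alpha,V)$, let $n,m\ge1$, and condition on the restriction of $\Pi$ to $[n]$ being a given partition into $j$ blocks with sizes $(n_1,\dots,n_j)$. Let $K_m$ be the number of new blocks generated by the integers $n+1,\dots,n+m$, $(S_1,\dots,S_{K_m})$ the sizes of the new blocks in exchangeable random order, and $S_m=\sum_{i=1}^{K_m}S_i$ the total number of integers in new blocks. Then for all $1\le k\le s\le m$ and all compositions $(s_1,\dots,s_k)$ of $s$ into positive integers, $$\mathbb{P}(K_m=k,S_m=s,S_1=s_1,\dots,S_{K_m}=s_k\mid n_1,\dots,n_j)=\frac{s!}{s_1!\cdots s_k!\,k!}\frac{V_{n+m,j+k}}{V_{n,j}}\binom ms(n-j\alpha)_{m-s}\prod_{i=1}^k(1-\alpha)_{s_i-1}$$ $$=\frac{m!}{s_1!\cdots s_k!\,k!\,(m-s)!}\frac{V_{n+m,j+k}}{V_{n,j}}(n-j\alpha)_{m-s}\prod_{i=1}^k(1-\alpha)_{s_i-1}.$$ Moreover, whenever the conditioning events have positive probability, $$\mathbb{P}(K_m=k,S_1=s_1,\dots,S_{K_m}=s_k\mid K_n=j,S_m=s)=\frac{s!}{s_1!\cdots s_k!\,k!}\frac{V_{n+m,j+k}}{\sum_{i=0}^sV_{n+m,j+i}S^{-1,-\alpha}_{s,i}}\prod_{i=1}^k(1-\alpha)_{s_i-1},$$ $$\mathbb{P}(S_1=s_1,\dots,S_{K_m}=s_k\mid K_m=k,S_m=s,K_n=j)=\frac{s!}{s_1!\cdots s_k!\,k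!}\frac{\prod_{i=1}^k(1-\alpha)_{s_i-1}}{S^{-1,-\alpha}_{s,k}}.$$
   Context: Notation: $(x)_n=x(x+1)\cdots(x+n-1)$ ($(x)_0=1$). Gibbs partition with parameters $(\alpha,V)$: $\alpha\in(-\infty,1)$ and $V=(V_{n,k})_{1\le k\le n}$ are nonnegative weights with $V_{1,1}=1$ and $V_{n,k}=(n-k\alpha)V_{n+1,k}+V_{n+1,k+1}$; $\Pi$ is the exchangeable random partition of the positive integers such that for every $n$ and every partition $\{A_1,\dots,A_k\}$ of $[n]=\{1,\dots,n\}$, the restriction $\Pi_n$ of $\Pi$ to $[n]$ satisfies $\mathbb{P}(\Pi_n=\{A_1,\dots,A_k\})=V_{n,k}\prod_{i=1}^k(1-\alpha)_{|A_i|-1}$. $K_n$ is the number of blocks of $\Pi_n$. Conditional setting: it is assumed $V_{n,j}>0$. Given $\Pi_n$ (with $j$ blocks of sizes $n_1,\dots,n_j$), a block of $\Pi_{n+m}$ is old if it meets $[n]$, new otherwise. Exchangeable random order: given the new blocks, they are listed in uniformly random order (independent of everything else). The conditional probability that $\Pi_{n+m}$ equals a specified partition extending $\Pi_n$, in which the old blocks gain $m_1,\dots,m_j\ge0$ elements and there are $k$ new blocks of sizes $s_1,\dots,s_k\ge1$, is $\frac{V_{n+m,j+k}}{V_{n,j}}\prod_{i=1}^j(n_i-\alpha)_{m_i}\prod_{i=1}^k(1-\alpha)_{s_i-1}$. Generalized central Stirling numbers: $S^{-1,-\alpha}_{n,k}=\frac{n!}{k!}\sum_{(n_1,\dots,n_k)}\prod_{j=1}^k\frac{(1-\alpha)_{n_j-1}}{n_j!}$,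 the sum being over compositions of $n$ into $k$ positive parts ($S_{0,0}^{-1,-\alpha}=1$, $S_{n,0}^{-1,-\alpha}=0$ for $n\ge1$, $S_{n,k}^{-1,-\alpha}=0$ for $k>n$). *)

theory Defs
  imports "HOL-Probability.Probability" "HOL-Combinatorics.Multiset_Permutations"
begin

definition restrict_part :: "nat \<Rightarrow> nat set set \<Rightarrow> nat set set" where
  "restrict_part n P = (\<inter>) {1..n} ` P - {{}}"

text \<open>The law below depends on a partition of \<open>[n]\<close> only through its block sizes, so
  exchangeability of the random partition is a consequence and not a separate assumption.
  The weights \<open>V n k\<close> are only meaningful for \<open>1 \<le> k \<le> n\<close>.\<close>

locale gibbs_partition = prob_space M for M :: "'a measure" +
  fixes \<alpha> :: real and V :: "nat \<Rightarrow> nat \<Rightarrow> real" and X :: "'a \<Rightarrow> nat set set"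
  assumes alpha_less_1: "\<alpha> < 1"
    and V_nonneg: "\<And>n k. 1 \<le> k \<Longrightarrow> k \<le> n \<Longrightarrow> 0 \<le> V n k"
    and V_1_1: "V 1 1 = 1"
    and V_rec: "\<And>n k. 1 \<le> k \<Longrightarrow> k \<le> n \<Longrightarrow>
      V n k = (real n - real k * \<alpha>) * V (n + 1) k + V (n + 1) (k + 1)"
    and partition: "\<And>\<omega>. \<omega> \<in> space M \<Longrightarrow> partition_on {1..} (X \<omega>)"
    and measurable_restrict:
      "\<And>n. (\<lambda>\<omega>. restrict_part n (X \<omega>)) \<in> M \<rightarrow>\<^sub>M count_space UNIV"
    and law: "\<And>n P. 1 \<le> n \<Longrightarrow> partition_on {1..n} P \<Longrightarrow>
      \<P>(\<omega> in M. restrict_part n (X \<omega>) = P)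
        = V n (card P) * (\<Prod>B\<in>P. pochhammer (1 - \<alpha>) (card B - 1))"

definition new_blocks :: "nat \<Rightarrow> nat \<Rightarrow> nat set set \<Rightarrow> nat set set" where
  "new_blocks n m P = {B \<in> restrict_part (n + m) P. B \<inter> {1..n} = {}}"

text \<open>The \<open>\<sigma>\<close>-algebra generated by the random partition.\<close>

definition partition_events :: "'a measure \<Rightarrow> ('a \<Rightarrow> nat set set) \<Rightarrow> 'a set set" where
  "partition_events M X =
     sigma_sets (space M) {{\<omega> \<in> space M. restrict_part N (X \<omega>) = P} | N P. True}"

text \<open>\<open>L\<close> lists the new blocks in exchangeable random order: given that the set of new blocks
  is \<open>\<B>\<close>, the list is uniform on the \<open>card \<B>!\<close> enumerations of \<open>\<B>\<close>, independently of
  any event \<open>A\<close> determined by the partition.\<close>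

definition exchangeable_order ::
  "'a measure \<Rightarrow> ('a \<Rightarrow> nat set set) \<Rightarrow> nat \<Rightarrow> nat \<Rightarrow> ('a \<Rightarrow> nat set list) \<Rightarrow> bool" where
  "exchangeable_order M X n m L \<longleftrightarrow>
     L \<in> M \<rightarrow>\<^sub>M count_space UNIV \<and>
     (\<forall>\<omega>\<in>space M. L \<omega> \<in> permutations_of_set (new_blocks n m (X \<omega>))) \<and>
     (\<forall>A\<in>partition_events M X. \<forall>\<B>. \<forall>l\<in>permutations_of_set \<B>.
        \<P>(\<omega> in M. \<omega> \<in> A \<and> new_blocks n m (X \<omega>) = \<B> \<and> L \<omega> = l)
          = \<P>(\<omega> in M. \<omega> \<in> A \<and> new_blocks n m (X \<omega>) = \<B>) / fact (card \<B>))"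

definition compositions :: "nat \<Rightarrow> nat \<Rightarrow> nat list set" where
  "compositions n k = {ns. length ns = k \<and> sum_list ns = n \<and> (\<forall>x\<in>set ns. 1 \<le> x)}"

text \<open>\<open>gen_stirling \<alpha> n k\<close> is the generalized central Stirling number
  \<open>S\<close> with upper index \<open>(-1, -\<alpha>)\<close> and lower index \<open>(n, k)\<close>.\<close>

definition gen_stirling :: "real \<Rightarrow> nat \<Rightarrow> nat \<Rightarrow> real" where
  "gen_stirling \<alpha> n k = fact n / fact k *
     (\<Sum>ns\<in>compositions n k. \<Prod>x\<leftarrow>ns. pochhammer (1 - \<alpha>) (x - 1) / fact x)"

lemma gen_stirling_0_0: "gen_stirling \<alpha> 0 0 = 1"
proof -
  have "compositions 0 0 = {[]}"
    by (auto simp: compositions_def)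
  then show ?thesis
    by (simp add: gen_stirling_def)
qed

lemma gen_stirling_n_0: "1 \<le> n \<Longrightarrow> gen_stirling \<alpha> n 0 = 0"
proof -
  assume "1 \<le> n"
  then have "compositions n 0 = {}"
    by (auto simp: compositions_def)
  then show ?thesis
    by (simp add: gen_stirling_def)
qed

lemma length_le_sum_list: "(\<forall>x\<in>set ns. (1::nat) \<le> x) \<Longrightarrow> length ns \<le> sum_list ns"
  by (induction ns) auto

lemma gen_stirling_eq_0: "n < k \<Longrightarrow> gen_stirling \<alpha> n k = 0"
proof -
  assume "n < k"
  then have "compositions n k = {}"
    using length_le_sum_list by (fastforce simp: compositions_def)
  then show ?thesis
    by (simp add: gen_stirling_def)
qed

end

theory Submission
  imports Defs
begin

text \<open>Given the restriction \<open>P\<close> to \<open>[n]\<close> with \<open>j\<close> blocks and the set of new blocks, the elements of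
  \<open>{n+1..n+m}\<close> outside the new blocks are inserted into old blocks one at a time. Inserting an
  element into a block of size \<open>b\<close> multiplies the weight by \<open>b - \<alpha>\<close>, so inserting it into all blocks
  of a partition of an \<open>r\<close>-element set contributes the factor \<open>r - j\<alpha>\<close>, which depends only on \<open>r\<close>
  and \<open>j\<close>. The sum over all extensions therefore telescopes to a Pochhammer symbol. The random order
  divides by \<open>k!\<close>, and the lists of disjoint new blocks with prescribed sizes are counted by a
  multinomial coefficient. The two other laws arise by summing over \<open>P\<close> and over compositions:
  the factors depending on \<open>n\<close>, \<open>j\<close>, \<open>m\<close>, \<open>s\<close> only are common to numerator and denominator.\<close>

section \<open>Extensions of a partition that create no new block\<close>

text \<open>Empty traces on \<open>A\<close> are not discarded here. For
  \<open>{} \<notin> P\<close> every block of \<open>Q\<close> must therefore meet \<open>A\<close>,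
  so all elements of \<open>R\<close> join old blocks.\<close>

definition extensions :: "'a set \<Rightarrow> 'a set \<Rightarrow> 'a set set \<Rightarrow> 'a set set set" where
  "extensions A R P = {Q. partition_on (A \<union> R) Q \<and> (\<inter>) A ` Q = P}"

lemma extensions_empty:
  assumes "partition_on A P"
  shows "extensions A {} P = {P}"
proof -
  have "(\<inter>) A ` Q = Q" if "partition_on A Q" for Q
  proof -
    have "A \<inter> B = B" if "B \<in> Q" for B
      using that \<open>partition_on A Q\<close> by (auto simp: partition_on_def)
    then show ?thesis by force
  qed
  then show ?thesis
    using assms by (auto simp: extensions_def)
qed

lemma finite_extensions: "finite A \<Longrightarrow> finite R \<Longrightarrow> finite (extensions A R P)"
  by (rule finite_subset[OF _ finitely_many_partition_on[of "A \<union> R"]])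
    (auto simp: extensions_def)

text \<open>Deleting \<open>x\<close> from its block undoes the insertion. Since every block meets
  \<open>A\<close> and \<open>x\<close> lies outside \<open>A\<close>, the deletion never leaves an
  empty block; this is where \<open>{} \<notin> P\<close> enters.\<close>

lemma bij_betw_extensions_insert:
  assumes "x \<notin> A" "x \<notin> R" "{} \<notin> P"
  shows "bij_betw (\<lambda>(Q, B). insert (insert x B) (Q - {B}))
    (SIGMA Q:extensions A R P. Q) (extensions A (insert x R) P)"
\<comment> \<open>Exactly one block contains \<open>x\<close>, so the union in the second component
  of the witness is that block.\<close>
proof (rule bij_betw_byWitness
    [where f' = "\<lambda>Q. ((\<lambda>C. C - {x}) ` Q, \<Union>{C \<in> Q. x \<in> C} - {x})"])
  have fwd: "insert (insert x B) (Q - {B}) \<in> extensions A (insert x R) P \<and>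
      (\<lambda>C. C - {x}) ` insert (insert x B) (Q - {B}) = Q \<and>
      \<Union>{C \<in> insert (insert x B) (Q - {B}). x \<in> C} - {x} = B"
    if "Q \<in> extensions A R P" "B \<in> Q" for Q B
  proof -
    have Q: "partition_on (A \<union> R) Q" and P: "(\<inter>) A ` Q = P"
      using that by (auto simp: extensions_def)
    have x: "x \<notin> C" if "C \<in> Q" for C
      using Q that assms by (auto simp: partition_on_def)
    have disj: "C \<inter> D = {}" if "C \<in> Q" "D \<in> Q" "C \<noteq> D" for C D
      using Q that by (auto simp: partition_on_def disjoint_def)
    have "partition_on (A \<union> insert x R) (insert (insert x B) (Q - {B}))"
    proof (rule partition_onI)
      show "\<Union> (insert (insert x B) (Q - {B})) = A \<union> insert x R"
        using Q \<open>B \<in> Q\<close> by (auto simp: partition_on_def)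
      show "{} \<notin> insert (insert x B) (Q - {B})"
        using Q by (auto simp: partition_on_def)
      show "disjnt C D" if "C \<in> insert (insert x B) (Q - {B})"
        "D \<in> insert (insert x B) (Q - {B})" "C \<noteq> D" for C D
        using that x disj \<open>B \<in> Q\<close> unfolding disjnt_def by blast
    qed
    moreover have "(\<inter>) A ` insert (insert x B) (Q - {B}) = P"
      using P \<open>B \<in> Q\<close> assms(1) by auto
    moreover have "(\<lambda>C. C - {x}) ` (Q - {B}) = Q - {B}"
      using x by force
    ultimately show ?thesis
      using x \<open>B \<in> Q\<close> unfolding extensions_def by auto
  qed
  have bwd: "(\<lambda>C. C - {x}) ` Q \<in> extensions A R P \<and>
      \<Union>{C \<in> Q. x \<in> C} - {x} \<in> (\<lambda>C. C - {x}) ` Q \<and>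
      insert (insert x (\<Union>{C \<in> Q. x \<in> C} - {x}))
        ((\<lambda>C. C - {x}) ` Q - {\<Union>{C \<in> Q. x \<in> C} - {x}}) = Q"
    if "Q \<in> extensions A (insert x R) P" for Q
  proof -
    have Q: "partition_on (A \<union> insert x R) Q" and P: "(\<inter>) A ` Q = P"
      using that by (auto simp: extensions_def)
    have disj: "C \<inter> D = {}" if "C \<in> Q" "D \<in> Q" "C \<noteq> D" for C D
      using Q that by (auto simp: partition_on_def disjoint_def)
    obtain C where C: "C \<in> Q" "x \<in> C"
      using Q by (auto simp: partition_on_def)
    have x: "x \<notin> D" if "D \<in> Q" "D \<noteq> C" for D
      using disj that C by blast
    have block: "{C \<in> Q. x \<in> C} = {C}"
      using C x by auto
    have rest: "(\<lambda>C. C - {x}) ` (Q - {C}) = Q - {C}"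
      using x by force
    have img: "(\<lambda>C. C - {x}) ` Q = insert (C - {x}) (Q - {C})"
      using rest C by blast
    have meet: "A \<inter> D \<noteq> {}" if "D \<in> Q" for D
      using P that assms(3) by (metis image_eqI)
    \<comment> \<open>Otherwise undoing the deletion would lose a second block equal to
      \<open>C - {x}\<close>. Such a block would be disjoint from \<open>C\<close>, although
      \<open>C\<close> meets \<open>A\<close> in points other than \<open>x\<close>.\<close>
    have new: "C - {x} \<notin> Q - {C}"
    proof
      assume "C - {x} \<in> Q - {C}"
      then have "C \<inter> (C - {x}) = {}" using disj C by blast
      then show False using meet[OF C(1)] assms(1) by auto
    qed
    have "partition_on (A \<union> R) (insert (C - {x}) (Q - {C}))"
    proof (rule partition_onI)
      have "\<Union>Q = A \<union> insert x R" using Q by (auto simp: partition_on_def)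
      then have "\<Union> ((\<lambda>C. C - {x}) ` Q) = (A \<union> insert x R) - {x}" by blast
      then show "\<Union> (insert (C - {x}) (Q - {C})) = A \<union> R"
        using img assms by auto
      show "{} \<notin> insert (C - {x}) (Q - {C})"
        using meet C assms(1) by blast
      show "disjnt D E" if "D \<in> insert (C - {x}) (Q - {C})"
        "E \<in> insert (C - {x}) (Q - {C})" "D \<noteq> E" for D E
        using that disj C unfolding disjnt_def by blast
    qed
    moreover have "(\<inter>) A ` insert (C - {x}) (Q - {C}) = P"
    proof -
      have "A \<inter> (C - {x}) = A \<inter> C" using assms(1) by auto
      then show ?thesis using P C by blast
    qed
    moreover have "insert x (C - {x}) = C" using C by auto
    ultimately show ?thesis
      unfolding block img extensions_def using new C by auto
  qed
  show "\<forall>a\<in>SIGMA Q:extensions A R P. Q.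
      (\<lambda>Q. ((\<lambda>C. C - {x}) ` Q, \<Union>{C \<in> Q. x \<in> C} - {x}))
        (case a of (Q, B) \<Rightarrow> insert (insert x B) (Q - {B})) = a"
    using fwd by auto
  show "\<forall>Q\<in>extensions A (insert x R) P.
      (case ((\<lambda>C. C - {x}) ` Q, \<Union>{C \<in> Q. x \<in> C} - {x}) of
        (Q, B) \<Rightarrow> insert (insert x B) (Q - {B})) = Q"
    using bwd by auto
  show "(\<lambda>(Q, B). insert (insert x B) (Q - {B})) ` (SIGMA Q:extensions A R P. Q)
      \<subseteq> extensions A (insert x R) P"
    using fwd by auto
  show "(\<lambda>Q. ((\<lambda>C. C - {x}) ` Q, \<Union>{C \<in> Q. x \<in> C} - {x})) ` extensions A (insert x R) P
      \<subseteq> (SIGMA Q:extensions A R P. Q)"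
    using bwd by auto
qed

text \<open>Blocks with the same trace on \<open>A\<close> share a point, because the trace is
  nonempty, so they coincide. Taking traces is thus injective on \<open>Q\<close>.\<close>

lemma card_extension:
  assumes "Q \<in> extensions A R P" "{} \<notin> P"
  shows "card Q = card P"
proof -
  have "inj_on ((\<inter>) A) Q"
  proof (rule inj_onI)
    fix B C assume BC: "B \<in> Q" "C \<in> Q" "A \<inter> B = A \<inter> C"
    have "A \<inter> B \<noteq> {}"
      using assms BC by (auto simp: extensions_def)
    then have "B \<inter> C \<noteq> {}"
      using BC by blast
    then show "B = C"
      using assms BC unfolding extensions_def partition_on_def disjoint_def by blast
  qed
  then show ?thesis
    using assms card_image by (fastforce simp: extensions_def)
qed

section \<open>Block weights and their sum over extensions\<close>

definition block_weight :: "real \<Rightarrow> 'a set set \<Rightarrow> real" where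
  "block_weight \<alpha> P = (\<Prod>B\<in>P. pochhammer (1 - \<alpha>) (card B - 1))"

text \<open>Only the factor of \<open>B\<close> changes: its Pochhammer index rises from
  \<open>card B - 1\<close> to \<open>card B\<close>, and the additional factor is
  \<open>1 - \<alpha> + (card B - 1)\<close>.\<close>

lemma block_weight_enlarge:
  assumes "partition_on A P" "finite A" "B \<in> P" "x \<notin> A"
  shows "block_weight \<alpha> (insert (insert x B) (P - {B})) = (real (card B) - \<alpha>) * block_weight \<alpha> P"
proof -
  have fin: "finite P" "finite B"
    using assms by (auto intro: finite_elements finite_subset simp: partition_on_def)
  have "x \<notin> B" "insert x B \<notin> P - {B}" "B \<noteq> {}"
    using assms by (auto simp: partition_on_def)
  \<comment> \<open>A block is nonempty, so the truncated subtraction \<open>card B - 1\<close> is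
    exact.\<close>
  then obtain b where b: "card B = Suc b"
    using fin by (metis card_0_eq not0_implies_Suc)
  have "block_weight \<alpha> (insert (insert x B) (P - {B}))
      = pochhammer (1 - \<alpha>) (Suc b) * block_weight \<alpha> (P - {B})"
    using fin \<open>insert x B \<notin> P - {B}\<close> \<open>x \<notin> B\<close> b by (simp add: block_weight_def)
  also have "\<dots> = (real (card B) - \<alpha>) * (pochhammer (1 - \<alpha>) b * block_weight \<alpha> (P - {B}))"
    by (simp add: pochhammer_Suc b algebra_simps)
  also have "pochhammer (1 - \<alpha>) b * block_weight \<alpha> (P - {B}) = block_weight \<alpha> P"
    using fin assms(3) b by (simp add: block_weight_def prod.remove[of P B])
  finally show ?thesis .
qed

lemma sum_card_partition:
  assumes "partition_on A P" "finite A"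
  shows "(\<Sum>B\<in>P. real (card B) - \<alpha>) = real (card A) - real (card P) * \<alpha>"
proof -
  have "card A = (\<Sum>B\<in>P. card B)"
    using assms product_partition[of A P] by (auto simp: partition_on_def intro: finite_subset)
  then show ?thesis
    by (simp add: sum_subtractf)
qed

text \<open>Induction over \<open>R\<close>. The choices of a block for \<open>x\<close> multiply
  the weight of \<open>Q\<close> by a total that is the same for every \<open>Q\<close>, since all
  extensions have the same ground set and, by \<open>card_extension\<close>, the same number of
  blocks. It leaves the sum as the last factor of the Pochhammer symbol.\<close>

lemma sum_extensions_weight:
  assumes "finite A" "finite R" "A \<inter> R = {}" "partition_on A P"
  shows "(\<Sum>Q\<in>extensions A R P. block_weight \<alpha> Q)
    = block_weight \<alpha> P * pochhammer (real (card A) - real (card P) * \<alpha>) (card R)"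
  using assms(2,3)
proof (induction R)
  case empty
  then show ?case by (simp add: extensions_empty[OF assms(4)])
next
  case (insert x R)
  have P: "{} \<notin> P" using assms(4) by (auto simp: partition_on_def)
  have fin: "finite Q" if "Q \<in> extensions A R P" for Q
    using that assms(1) insert.hyps by (auto simp: extensions_def intro: finite_elements)
  have "(\<Sum>Q\<in>extensions A (insert x R) P. block_weight \<alpha> Q)
      = (\<Sum>(Q, B)\<in>(SIGMA Q:extensions A R P. Q). block_weight \<alpha> (insert (insert x B) (Q - {B})))"
    using bij_betw_extensions_insert[of x A R P] insert.hyps insert.prems P
    by (subst sum.reindex_bij_betw[symmetric]) (auto simp: case_prod_unfold)
  also have "\<dots> = (\<Sum>Q\<in>extensions A R P. \<Sum>B\<in>Q. block_weight \<alpha> (insert (insert x B) (Q - {B})))"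
    using fin assms(1) insert.hyps by (simp add: sum.Sigma finite_extensions)
  also have "\<dots> = (\<Sum>Q\<in>extensions A R P. block_weight \<alpha> Q *
      (real (card A) - real (card P) * \<alpha> + real (card R)))"
  proof (rule sum.cong[OF refl])
    fix Q assume Q: "Q \<in> extensions A R P"
    then have part: "partition_on (A \<union> R) Q" by (simp add: extensions_def)
    have "(\<Sum>B\<in>Q. block_weight \<alpha> (insert (insert x B) (Q - {B})))
        = (\<Sum>B\<in>Q. (real (card B) - \<alpha>) * block_weight \<alpha> Q)"
      using insert assms(1) by (intro sum.cong refl block_weight_enlarge[OF part]) auto
    also have "\<dots> = block_weight \<alpha> Q * (real (card (A \<union> R)) - real (card Q) * \<alpha>)"
      using sum_card_partition[OF part] assms(1) insert.hyps
      by (simp add: sum_distrib_right[symmetric])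
    also have "real (card (A \<union> R)) - real (card Q) * \<alpha>
        = real (card A) - real (card P) * \<alpha> + real (card R)"
      using insert assms(1) card_extension[OF Q P] by (simp add: card_Un_disjoint)
    finally show "(\<Sum>B\<in>Q. block_weight \<alpha> (insert (insert x B) (Q - {B})))
        = block_weight \<alpha> Q * (real (card A) - real (card P) * \<alpha> + real (card R))" .
  qed
  also have "\<dots> = block_weight \<alpha> P *
      pochhammer (real (card A) - real (card P) * \<alpha>) (card (insert x R))"
    using insert by (simp add: sum_distrib_right[symmetric] pochhammer_Suc)
  finally show ?case .
qed

section \<open>Counting lists of disjoint blocks with prescribed sizes\<close>

fun block_lists :: "'a set \<Rightarrow> nat list \<Rightarrow> 'a set list set" where
  "block_lists U [] = {[]}"
| "block_lists U (x # xs) = (\<Union>B\<in>{B. B \<subseteq> U \<and> card B = x}. (#) B ` block_lists (U - B) xs)"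

text \<open>Each block is chosen from what the earlier ones leave over. With size 0 excluded all
  choices are nonempty, and disjointness then gives distinct entries and a partition of their
  union.\<close>

lemma in_block_lists_iff:
  assumes "finite U" "0 \<notin> set ss"
  shows "l \<in> block_lists U ss \<longleftrightarrow>
    map card l = ss \<and> distinct l \<and> partition_on (\<Union>(set l)) (set l) \<and> \<Union>(set l) \<subseteq> U"
  using assms
proof (induction ss arbitrary: U l)
  case Nil
  then show ?case by (auto simp: partition_on_def)
next
  case (Cons x xs)
  show ?case
  proof (cases l)
    case Nil
    then show ?thesis by auto
  next
    case (Cons B l')
    have "B \<noteq> {}" if "card B = x"
      using Cons.prems that by auto
    have "l \<in> block_lists U (x # xs) \<longleftrightarrow> B \<subseteq> U \<and> card B = x \<and> l' \<in> block_lists (U - B) xs"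
      using Cons by auto
    also have "\<dots> \<longleftrightarrow> B \<subseteq> U \<and> card B = x \<and> map card l' = xs \<and> distinct l' \<and>
        partition_on (\<Union>(set l')) (set l') \<and> \<Union>(set l') \<subseteq> U - B"
      using Cons.prems Cons.IH[of "U - B" l'] by simp
    also have "\<dots> \<longleftrightarrow> map card l = x # xs \<and> distinct l \<and>
        partition_on (\<Union>(set l)) (set l) \<and> \<Union>(set l) \<subseteq> U"
      using \<open>card B = x \<Longrightarrow> B \<noteq> {}\<close> unfolding Cons partition_on_def disjoint_def
      by auto blast+
    finally show ?thesis .
  qed
qed

lemma finite_block_lists: "finite U \<Longrightarrow> finite (block_lists U ss)"
  by (induction ss arbitrary: U) auto

text \<open>The first block has \<open>card U choose x\<close> choices, and the count for the rest
  depends only on \<open>card U - x\<close>. The binomial coefficients telescope to a multinomial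
  coefficient whose last class holds the leftover elements.\<close>

lemma card_block_lists:
  assumes "finite U" "sum_list ss \<le> card U"
  shows "real (card (block_lists U ss))
    = fact (card U) / ((\<Prod>x\<leftarrow>ss. fact x) * fact (card U - sum_list ss))"
  using assms
proof (induction ss arbitrary: U)
  case Nil
  then show ?case by simp
next
  case (Cons x xs)
  let ?c = "fact (card U - x) / ((\<Prod>x\<leftarrow>xs. fact x) * fact (card U - x - sum_list xs)) :: real"
  have "card (block_lists U (x # xs))
      = (\<Sum>B | B \<subseteq> U \<and> card B = x. card ((#) B ` block_lists (U - B) xs))"
    unfolding block_lists.simps
    using Cons.prems by (intro card_UN_disjoint) (auto simp: finite_block_lists)
  also have "\<dots> = (\<Sum>B | B \<subseteq> U \<and> card B = x. card (block_lists (U - B) xs))"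
    by (intro sum.cong refl card_image) auto
  finally have "real (card (block_lists U (x # xs)))
      = (\<Sum>B | B \<subseteq> U \<and> card B = x. real (card (block_lists (U - B) xs)))"
    by simp
  also have "\<dots> = (\<Sum>B | B \<subseteq> U \<and> card B = x. ?c)"
  proof (intro sum.cong refl)
    fix B assume "B \<in> {B. B \<subseteq> U \<and> card B = x}"
    then have "card (U - B) = card U - x"
      using Cons.prems by (auto simp: card_Diff_subset finite_subset)
    then show "real (card (block_lists (U - B) xs)) = ?c"
      using Cons.IH[of "U - B"] Cons.prems by simp
  qed
  also have "\<dots> = real (card U choose x) * ?c"
    using Cons.prems by (simp add: n_subsets)
  also have "\<dots> = fact (card U) / ((\<Prod>x\<leftarrow>x # xs. fact x) * fact (card U - sum_list (x # xs)))"
    using Cons.prems by (simp add: binomial_fact)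
  finally show ?case .
qed

section \<open>Splitting a partition into old and new blocks\<close>

text \<open>The new blocks cover exactly \<open>W\<close>, so the old ones cover
  \<open>A \<union> (T - W)\<close> and form an extension of \<open>P\<close>. The empty trace
  removed on the left is the one left by new blocks.\<close>

lemma partition_with_new_blocks_iff:
  assumes "A \<inter> T = {}" "partition_on W N" "W \<subseteq> T" "{} \<notin> P" "partition_on (A \<union> T) Q"
  shows "(\<inter>) A ` Q - {{}} = P \<and> {B \<in> Q. B \<inter> A = {}} = N \<longleftrightarrow>
    (\<exists>Q'\<in>extensions A (T - W) P. Q = Q' \<union> N)" (is "?L \<longleftrightarrow> ?R")
proof
  assume L: ?L
  define Q' where "Q' = {B \<in> Q. B \<inter> A \<noteq> {}}"
  have QN: "Q = Q' \<union> N" "Q' \<inter> N = {}"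
    using L by (auto simp: Q'_def)
  have disj: "B \<inter> C = {}" if "B \<in> Q" "C \<in> Q" "B \<noteq> C" for B C
    using assms(5) that by (auto simp: partition_on_def disjoint_def)
  have "\<Union>Q' \<inter> \<Union>N = {}"
    using disj QN by blast
  moreover have "\<Union>Q' \<union> \<Union>N = A \<union> T" "\<Union>N = W"
    using assms(2,5) QN by (auto simp: partition_on_def)
  ultimately have "\<Union>Q' = A \<union> (T - W)"
    using assms(1,3) by blast
  then have "partition_on (A \<union> (T - W)) Q'"
    using assms(5) QN by (auto simp: partition_on_def disjoint_def)
  moreover have "(\<inter>) A ` Q' = P"
    using L unfolding Q'_def by blast
  ultimately show ?R
    using QN by (auto simp: extensions_def)
next
  assume ?R
  then obtain Q' where Q': "Q' \<in> extensions A (T - W) P" "Q = Q' \<union> N" by blast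
  have meet: "B \<inter> A \<noteq> {}" if "B \<in> Q'" for B
    using Q' assms(4) that by (auto simp: extensions_def)
  have "B \<inter> A = {}" if "B \<in> N" for B
    using assms(1-3) that by (auto simp: partition_on_def)
  then have "{B \<in> Q. B \<inter> A = {}} = N" "(\<inter>) A ` Q - {{}} = (\<inter>) A ` Q'"
    using meet Q'(2) by blast+
  then show ?L
    using Q' by (auto simp: extensions_def)
qed

text \<open>The Gibbs law speaks of partitions only; this makes it applicable to the unions
  \<open>Q \<union> N\<close>.\<close>

lemma partition_on_extension_Un:
  assumes "A \<inter> T = {}" "partition_on W N" "W \<subseteq> T" "Q \<in> extensions A (T - W) P"
  shows "partition_on (A \<union> T) (Q \<union> N)"
proof (rule partition_onI)
  have Q: "\<Union>Q = A \<union> (T - W)" "disjoint Q" "{} \<notin> Q"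
    using assms(4) by (auto simp: extensions_def partition_on_def)
  have N: "\<Union>N = W" "disjoint N" "{} \<notin> N"
    using assms(2) by (auto simp: partition_on_def)
  show "\<Union>(Q \<union> N) = A \<union> T"
    using Q N assms(3) by auto
  show "{} \<notin> Q \<union> N"
    using Q N by simp
  have "\<Union>Q \<inter> \<Union>N = {}"
    using Q N assms(1,3) by auto
  then show "disjnt B C" if "B \<in> Q \<union> N" "C \<in> Q \<union> N" "B \<noteq> C" for B C
    using Q(2) N(2) that unfolding disjoint_def disjnt_def by blast
qed

text \<open>Disjointness lets \<open>Q \<union> N\<close> determine \<open>Q\<close>, and makes
  block counts add and weights multiply.\<close>

lemma extension_disjoint_new_blocks:
  assumes "A \<inter> W = {}" "partition_on W N" "{} \<notin> P" "Q \<in> extensions A R P"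
  shows "Q \<inter> N = {}"
proof -
  have "A \<inter> B \<noteq> {}" if "B \<in> Q" for B
    using assms(3,4) that by (auto simp: extensions_def)
  moreover have "A \<inter> B = {}" if "B \<in> N" for B
    using assms(1,2) that by (auto simp: partition_on_def)
  ultimately show ?thesis by blast
qed

section \<open>Restrictions of partitions and decompositions of events\<close>

text \<open>The empty trace dropped by the inner restriction would be dropped by the outer one
  anyway.\<close>

lemma restrict_part_restrict_part:
  assumes "n \<le> N"
  shows "restrict_part n (restrict_part N P) = restrict_part n P"
proof -
  have int: "{1..n} \<inter> ({1..N} \<inter> B) = {1..n} \<inter> B" for B
    using assms by auto
  have "(\<inter>) {1..n} ` (\<F> - {{}}) - {{}} = (\<inter>) {1..n} ` \<F> - {{}}" for \<F>
    by auto
  then show ?thesis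
    by (simp add: restrict_part_def image_image int del: atLeastAtMost_iff One_nat_def)
qed

lemma partition_on_restrict_part:
  assumes "partition_on {1..} P"
  shows "partition_on {1..n} (restrict_part n P)"
  using partition_on_restrict[OF assms, of "{1..n}"]
  by (simp add: restrict_part_def Int_absorb2 atLeastAtMost_def)

lemma prod_list_pochhammer_eq_block_weight:
  "distinct l \<Longrightarrow> (\<Prod>x\<leftarrow>map card l. pochhammer (1 - \<alpha>) (x - 1)) = block_weight \<alpha> (set l)"
  by (simp add: block_weight_def prod.distinct_set_conv_list comp_def)

text \<open>A pointwise form of \<open>prob_sum\<close>: the events \<open>E i\<close> are exclusive
  and exhaust \<open>F\<close>. Every decomposition of a probability below goes through it.\<close>

lemma (in prob_space) prob_eq_sum:
  assumes "finite I" "\<And>i. i \<in> I \<Longrightarrow> {\<omega> \<in> space M. E i \<omega>} \<in> events"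
    and "{\<omega> \<in> space M. F \<omega>} \<in> events"
    and iff: "\<And>\<omega>. \<omega> \<in> space M \<Longrightarrow> F \<omega> \<longleftrightarrow> (\<exists>i\<in>I. E i \<omega>)"
    and unique: "\<And>i i' \<omega>. i \<in> I \<Longrightarrow> i' \<in> I \<Longrightarrow> E i \<omega> \<Longrightarrow> E i' \<omega> \<Longrightarrow> i = i'"
  shows "\<P>(\<omega> in M. F \<omega>) = (\<Sum>i\<in>I. \<P>(\<omega> in M. E i \<omega>))"
proof (rule prob_sum[OF assms(1-3)])
  show "AE \<omega> in M. (\<forall>i\<in>I. E i \<omega> \<longrightarrow> F \<omega>) \<and> (F \<omega> \<longrightarrow> (\<exists>!i\<in>I. E i \<omega>))"
    using iff unique by (intro AE_I2) (metis (no_types, lifting))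
qed

section \<open>Joint law of the restriction and the ordered new blocks\<close>

context gibbs_partition
begin

lemma prob_restrict_part_eq:
  "1 \<le> n \<Longrightarrow> partition_on {1..n} P \<Longrightarrow>
    \<P>(\<omega> in M. restrict_part n (X \<omega>) = P) = V n (card P) * block_weight \<alpha> P"
  by (simp add: law block_weight_def)

lemma sets_restrict_part:
  "{\<omega> \<in> space M. \<Phi> (restrict_part n (X \<omega>))} \<in> sets M"
  using measurable_sets[OF measurable_restrict[of n], of "Collect \<Phi>"]
  by (simp add: vimage_def Int_def conj_commute)

text \<open>Both quantities are functions of the restriction to \<open>{1..n + m}\<close>.\<close>

lemma sets_restrict_new_blocks:
  "{\<omega> \<in> space M. \<Phi> (restrict_part n (X \<omega>)) (new_blocks n m (X \<omega>))} \<in> sets M"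
  using sets_restrict_part[of "\<lambda>Q. \<Phi> (restrict_part n Q) {B \<in> Q. B \<inter> {1..n} = {}}" "n + m"]
  by (simp add: new_blocks_def restrict_part_restrict_part)

text \<open>The event splits according to the extension \<open>Q\<close> formed by the old blocks.
  All unions \<open>Q \<union> N\<close> have \<open>card P + card N\<close> blocks and so share one
  value of \<open>V\<close>; only the weight of \<open>Q\<close> varies, and
  \<open>sum_extensions_weight\<close> sums it. The index \<open>m - card W\<close> counts the
  integers that join old blocks.\<close>

lemma prob_restrict_new_blocks:
  assumes "1 \<le> n" "partition_on {1..n} P" "partition_on W N" "W \<subseteq> {n<..n + m}"
  shows "\<P>(\<omega> in M. restrict_part n (X \<omega>) = P \<and> new_blocks n m (X \<omega>) = N)
    = V (n + m) (card P + card N) * block_weight \<alpha> P * block_weight \<alpha> N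
      * pochhammer (real n - real (card P) * \<alpha>) (m - card W)"
proof -
  let ?A = "{1..n}" and ?T = "{n<..n + m}"
  let ?E = "extensions ?A (?T - W) P"
  have AT: "?A \<inter> ?T = {}" "?A \<union> ?T = {1..n + m}" "?A \<inter> W = {}" using assms(1,4) by auto
  have P: "{} \<notin> P" using assms(2) by (auto simp: partition_on_def)
  have finW: "finite W" using assms(4) finite_subset by blast
  have part: "partition_on {1..n + m} (Q \<union> N)" if "Q \<in> ?E" for Q
    using partition_on_extension_Un[OF AT(1) assms(3,4) that] AT by simp
  have disj: "Q \<inter> N = {}" if "Q \<in> ?E" for Q
    using extension_disjoint_new_blocks[OF AT(3) assms(3) P that] .
  have fin: "finite N" "finite Q" if "Q \<in> ?E" for Q
    using part[OF that] finite_elements by (auto dest!: finite_elements[rotated])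
  have iff: "restrict_part n (X \<omega>) = P \<and> new_blocks n m (X \<omega>) = N \<longleftrightarrow>
      (\<exists>Q\<in>?E. restrict_part (n + m) (X \<omega>) = Q \<union> N)" if "\<omega> \<in> space M" for \<omega>
  proof -
    have "partition_on (?A \<union> ?T) (restrict_part (n + m) (X \<omega>))"
      using AT partition_on_restrict_part[OF partition[OF that]] by simp
    from partition_with_new_blocks_iff[OF AT(1) assms(3,4) P this]
    moreover have "(\<inter>) ?A ` restrict_part (n + m) (X \<omega>) - {{}} = restrict_part n (X \<omega>)"
      using restrict_part_restrict_part[of n "n + m"] by (simp add: restrict_part_def[of n])
    ultimately show ?thesis
      by (simp add: new_blocks_def)
  qed
  have "\<P>(\<omega> in M. restrict_part n (X \<omega>) = P \<and> new_blocks n m (X \<omega>) = N)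
      = (\<Sum>Q\<in>?E. \<P>(\<omega> in M. restrict_part (n + m) (X \<omega>) = Q \<union> N))"
  proof (rule prob_eq_sum)
    show "finite ?E" by (simp add: finite_extensions)
    show "{\<omega> \<in> space M. restrict_part n (X \<omega>) = P \<and> new_blocks n m (X \<omega>) = N} \<in> events"
      by (rule sets_restrict_new_blocks)
    show "{\<omega> \<in> space M. restrict_part (n + m) (X \<omega>) = Q \<union> N} \<in> events" for Q
      by (rule sets_restrict_part)
    show "Q = Q'" if "Q \<in> ?E" "Q' \<in> ?E" "restrict_part (n + m) (X \<omega>) = Q \<union> N"
      "restrict_part (n + m) (X \<omega>) = Q' \<union> N" for Q Q' \<omega>
    proof -
      have "Q = (Q \<union> N) - N" "Q' = (Q' \<union> N) - N"
        using disj that(1,2) by auto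
      then show ?thesis using that(3,4) by simp
    qed
  qed (fact iff)
  also have "\<dots> = (\<Sum>Q\<in>?E. V (n + m) (card P + card N) * block_weight \<alpha> N * block_weight \<alpha> Q)"
  proof (rule sum.cong[OF refl])
    fix Q assume Q: "Q \<in> ?E"
    have "card (Q \<union> N) = card P + card N"
      using fin[OF Q] disj[OF Q] card_extension[OF Q P] by (simp add: card_Un_disjoint)
    moreover have "block_weight \<alpha> (Q \<union> N) = block_weight \<alpha> N * block_weight \<alpha> Q"
      using fin[OF Q] disj[OF Q] by (simp add: block_weight_def prod.union_disjoint)
    ultimately show "\<P>(\<omega> in M. restrict_part (n + m) (X \<omega>) = Q \<union> N)
        = V (n + m) (card P + card N) * block_weight \<alpha> N * block_weight \<alpha> Q"
      using prob_restrict_part_eq[OF _ part[OF Q]] assms(1) by simp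
  qed
  also have "\<dots> = V (n + m) (card P + card N) * block_weight \<alpha> P * block_weight \<alpha> N
      * pochhammer (real n - real (card P) * \<alpha>) (m - card W)"
  proof -
    have "?A \<inter> (?T - W) = {}" using AT by auto
    moreover have "card (?T - W) = m - card W"
      using assms(4) finW by (simp add: card_Diff_subset)
    ultimately show ?thesis
      using sum_extensions_weight[of ?A "?T - W" P \<alpha>] assms(2)
      unfolding sum_distrib_left[symmetric] by simp
  qed
  finally show ?thesis .
qed

lemma sets_restrict_order:
  assumes "exchangeable_order M X n m L"
  shows "{\<omega> \<in> space M. \<Phi> (restrict_part N (X \<omega>)) \<and> \<Psi> (L \<omega>)} \<in> sets M"
proof -
  have "L \<in> M \<rightarrow>\<^sub>M count_space UNIV"
    using assms by (simp add: exchangeable_order_def)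
  from measurable_sets[OF this, of "Collect \<Psi>"]
  have "{\<omega> \<in> space M. \<Psi> (L \<omega>)} \<in> sets M"
    by (simp add: vimage_def Int_def conj_commute)
  then show ?thesis
    using sets_restrict_part by (intro sets.sets_Collect_conj)
qed

lemma card_new_blocks_order:
  assumes "exchangeable_order M X n m L" "\<omega> \<in> space M"
  shows "card (new_blocks n m (X \<omega>)) = length (L \<omega>)"
  using assms
  by (auto simp: exchangeable_order_def permutations_of_set_def simp flip: distinct_card)

text \<open>New blocks lie in \<open>{1..n + m}\<close> and avoid \<open>{1..n}\<close>. The list is
  compared with its own sizes, so that prescribing the sizes later turns an event about
  \<open>L\<close> into membership in a finite set of lists.\<close>

lemma order_in_block_lists:
  assumes "exchangeable_order M X n m L" "\<omega> \<in> space M"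
  shows "L \<omega> \<in> block_lists {n<..n + m} (map card (L \<omega>))" "0 \<notin> set (map card (L \<omega>))"
proof -
  have L: "set (L \<omega>) = new_blocks n m (X \<omega>)" "distinct (L \<omega>)"
    using assms by (auto simp: exchangeable_order_def permutations_of_set_def)
  have part: "partition_on {1..n + m} (restrict_part (n + m) (X \<omega>))"
    by (rule partition_on_restrict_part[OF partition[OF assms(2)]])
  then have *: "B \<subseteq> {1..n + m}" "B \<noteq> {}" if "B \<in> restrict_part (n + m) (X \<omega>)" for B
    using that by (auto simp: partition_on_def)
  \<comment> \<open>As \<open>card\<close> is 0 for infinite sets too, finiteness of the blocks
    enters besides their being nonempty.\<close>
  show 0: "0 \<notin> set (map card (L \<omega>))"
  proof
    assume "0 \<in> set (map card (L \<omega>))"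
    then obtain B where "B \<in> restrict_part (n + m) (X \<omega>)" "card B = 0"
      using L by (auto simp: new_blocks_def)
    then show False using * finite_subset[of B "{1..n + m}"] by auto
  qed
  have "\<Union>(set (L \<omega>)) \<subseteq> {n<..n + m}"
  proof
    fix x assume "x \<in> \<Union>(set (L \<omega>))"
    then obtain B where "x \<in> B" "B \<in> restrict_part (n + m) (X \<omega>)" "B \<inter> {1..n} = {}"
      using L by (auto simp: new_blocks_def)
    then have "x \<in> {1..n + m}" "x \<notin> {1..n}"
      using *(1)[of B] by blast+
    then show "x \<in> {n<..n + m}" by auto
  qed
  moreover have "partition_on (\<Union>(set (L \<omega>))) (set (L \<omega>))"
    using part L by (auto simp: new_blocks_def partition_on_def disjoint_def)
  ultimately show "L \<omega> \<in> block_lists {n<..n + m} (map card (L \<omega>))"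
    using 0 L by (subst in_block_lists_iff) auto
qed

text \<open>All lists in \<open>block_lists\<close> have the same probability \<open>?c\<close>,
  which depends only on \<open>P\<close> and the sizes, so the sum is \<open>?c\<close> times the
  number of lists.\<close>

lemma prob_restrict_order:
  assumes "exchangeable_order M X n m L" "1 \<le> n" "partition_on {1..n} P"
    and ss: "0 \<notin> set ss" "sum_list ss \<le> m"
  shows "\<P>(\<omega> in M. restrict_part n (X \<omega>) = P \<and> map card (L \<omega>) = ss)
    = fact m / ((\<Prod>x\<leftarrow>ss. fact x) * fact (length ss) * fact (m - sum_list ss))
      * V (n + m) (card P + length ss)
      * pochhammer (real n - real (card P) * \<alpha>) (m - sum_list ss)
      * (\<Prod>x\<leftarrow>ss. pochhammer (1 - \<alpha>) (x - 1)) * block_weight \<alpha> P"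
proof -
  let ?U = "{n<..n + m}"
  let ?c = "V (n + m) (card P + length ss) * block_weight \<alpha> P
      * (\<Prod>x\<leftarrow>ss. pochhammer (1 - \<alpha>) (x - 1))
      * pochhammer (real n - real (card P) * \<alpha>) (m - sum_list ss) / fact (length ss)"
  have "\<P>(\<omega> in M. restrict_part n (X \<omega>) = P \<and> map card (L \<omega>) = ss)
      = (\<Sum>l\<in>block_lists ?U ss. \<P>(\<omega> in M. restrict_part n (X \<omega>) = P \<and> L \<omega> = l))"
  proof (rule prob_eq_sum)
    show "finite (block_lists ?U ss)" by (simp add: finite_block_lists)
    show "{\<omega> \<in> space M. restrict_part n (X \<omega>) = P \<and> map card (L \<omega>) = ss} \<in> events"
      by (rule sets_restrict_order[OF assms(1)])
    show "{\<omega> \<in> space M. restrict_part n (X \<omega>) = P \<and> L \<omega> = l} \<in> events" for l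
      by (rule sets_restrict_order[OF assms(1)])
    show "restrict_part n (X \<omega>) = P \<and> map card (L \<omega>) = ss \<longleftrightarrow>
        (\<exists>l\<in>block_lists ?U ss. restrict_part n (X \<omega>) = P \<and> L \<omega> = l)" if "\<omega> \<in> space M" for \<omega>
    proof -
      have "L \<omega> \<in> block_lists ?U ss \<longleftrightarrow> map card (L \<omega>) = ss"
        using order_in_block_lists(1)[OF assms(1) that] in_block_lists_iff[OF _ ss(1), of ?U]
        by auto
      then show ?thesis by auto
    qed
  qed auto
  also have "\<dots> = (\<Sum>l\<in>block_lists ?U ss. ?c)"
  proof (rule sum.cong[OF refl])
    fix l assume "l \<in> block_lists ?U ss"
    then have l: "map card l = ss" "distinct l" "partition_on (\<Union>(set l)) (set l)"
      "\<Union>(set l) \<subseteq> ?U"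
      using in_block_lists_iff[OF _ ss(1), of ?U] by auto
    have len: "card (set l) = length ss"
      using l by (auto simp: distinct_card)
    have "card (\<Union>(set l)) = (\<Sum>B\<in>set l. card B)"
      using l by (intro card_Union_disjoint)
        (auto simp: partition_on_def pairwise_def disjoint_def disjnt_def intro: finite_subset)
    then have sum: "card (\<Union>(set l)) = sum_list ss"
      using l by (simp add: sum.distinct_set_conv_list)
    let ?A = "{\<omega> \<in> space M. restrict_part n (X \<omega>) = P}"
    have A: "?A \<in> partition_events M X"
      by (auto simp: partition_events_def)
    have L: "set (L \<omega>) = new_blocks n m (X \<omega>)" if "\<omega> \<in> space M" for \<omega>
      using assms(1) that by (auto simp: exchangeable_order_def permutations_of_set_def)
    \<comment> \<open>The event \<open>L \<omega> = l\<close> already fixes the set of new blocks.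
      Naming that set brings the event into the form of \<open>exchangeable_order\<close>, which
      yields the factor 1/k!.\<close>
    have "\<P>(\<omega> in M. restrict_part n (X \<omega>) = P \<and> L \<omega> = l)
        = \<P>(\<omega> in M. \<omega> \<in> ?A \<and> new_blocks n m (X \<omega>) = set l \<and> L \<omega> = l)"
      using L by (intro arg_cong[where f = prob]) auto
    also have "\<dots> = \<P>(\<omega> in M. \<omega> \<in> ?A \<and> new_blocks n m (X \<omega>) = set l) / fact (card (set l))"
      using assms(1) A l(2) unfolding exchangeable_order_def permutations_of_set_def by blast
    also have "\<P>(\<omega> in M. \<omega> \<in> ?A \<and> new_blocks n m (X \<omega>) = set l)
        = \<P>(\<omega> in M. restrict_part n (X \<omega>) = P \<and> new_blocks n m (X \<omega>) = set l)"
      by (intro arg_cong[where f = prob]) auto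
    finally show "\<P>(\<omega> in M. restrict_part n (X \<omega>) = P \<and> L \<omega> = l) = ?c"
      using prob_restrict_new_blocks[OF assms(2,3) l(3,4)] l(1) len sum
        prod_list_pochhammer_eq_block_weight[OF l(2), of \<alpha>] by simp
  qed
  also have "\<dots> = fact m / ((\<Prod>x\<leftarrow>ss. fact x) * fact (m - sum_list ss)) * ?c"
    using card_block_lists[of ?U ss] ss(2) by simp
  finally show ?thesis by (simp add: mult_ac)
qed

end

section \<open>Summation over partitions with \<open>j\<close> blocks and over compositions\<close>

lemma finite_compositions: "finite (compositions n k)"
proof (rule finite_subset)
  show "compositions n k \<subseteq> {ns. set ns \<subseteq> {..n} \<and> length ns = k}"
    by (auto simp: compositions_def dest: member_le_sum_list)
qed (simp add: finite_lists_length_eq)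

lemma prod_list_divide:
  fixes f g :: "'b \<Rightarrow> 'c::field"
  shows "(\<Prod>x\<leftarrow>xs. f x) / (\<Prod>x\<leftarrow>xs. g x) = (\<Prod>x\<leftarrow>xs. f x / g x)"
  by (induction xs) (auto simp flip: times_divide_times_eq)

lemma block_weight_pos:
  assumes "\<alpha> < 1"
  shows "0 < block_weight \<alpha> P"
  using assms unfolding block_weight_def by (intro prod_pos pochhammer_pos) auto

text \<open>Mathematically the generalized Stirling number with lower index (n, j), written as a sum
  over set partitions. It stays one symbol because it cancels in the conditional laws.\<close>

definition total_weight :: "real \<Rightarrow> nat \<Rightarrow> nat \<Rightarrow> real" where
  "total_weight \<alpha> n j = (\<Sum>P | partition_on {1..n} P \<and> card P = j. block_weight \<alpha> P)"

context gibbs_partition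
begin

context
  fixes n m j s :: nat and L :: "'a \<Rightarrow> nat set list"
  assumes order: "exchangeable_order M X n m L" and n: "1 \<le> n" and s: "s \<le> m"
begin

text \<open>Collects what depends neither on the number of new blocks nor on their individual
  sizes.\<close>

abbreviation "common_factor \<equiv>
  fact m / fact (m - s) * pochhammer (real n - real j * \<alpha>) (m - s) * total_weight \<alpha> n j"

text \<open>In \<open>prob_restrict_order\<close> the partition \<open>P\<close> enters only through
  its number of blocks and its weight, so summing over all \<open>P\<close> with \<open>j\<close>
  blocks replaces the weight by \<open>total_weight\<close>.\<close>

lemma prob_card_order:
  assumes "ss \<in> compositions s k"
  shows "\<P>(\<omega> in M. card (restrict_part n (X \<omega>)) = j \<and> map card (L \<omega>) = ss)
    = common_factor * V (n + m) (j + k) / fact k * (\<Prod>x\<leftarrow>ss. pochhammer (1 - \<alpha>) (x - 1) / fact x)"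
proof -
  have ss: "length ss = k" "sum_list ss = s" "0 \<notin> set ss"
    using assms by (auto simp: compositions_def)
  let ?P = "{P. partition_on {1..n} P \<and> card P = j}"
  let ?c = "fact m / ((\<Prod>x\<leftarrow>ss. fact x) * fact k * fact (m - s))
      * V (n + m) (j + k) * pochhammer (real n - real j * \<alpha>) (m - s)
      * (\<Prod>x\<leftarrow>ss. pochhammer (1 - \<alpha>) (x - 1))"
  have "\<P>(\<omega> in M. card (restrict_part n (X \<omega>)) = j \<and> map card (L \<omega>) = ss)
      = (\<Sum>P\<in>?P. \<P>(\<omega> in M. restrict_part n (X \<omega>) = P \<and> map card (L \<omega>) = ss))"
  proof (rule prob_eq_sum)
    show "finite ?P"
      by (rule finite_subset[OF _ finitely_many_partition_on[of "{1..n}"]]) auto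
    show "{\<omega> \<in> space M. card (restrict_part n (X \<omega>)) = j \<and> map card (L \<omega>) = ss} \<in> events"
      by (rule sets_restrict_order[OF order])
    show "{\<omega> \<in> space M. restrict_part n (X \<omega>) = P \<and> map card (L \<omega>) = ss} \<in> events" for P
      by (rule sets_restrict_order[OF order])
    show "card (restrict_part n (X \<omega>)) = j \<and> map card (L \<omega>) = ss \<longleftrightarrow>
        (\<exists>P\<in>?P. restrict_part n (X \<omega>) = P \<and> map card (L \<omega>) = ss)" if "\<omega> \<in> space M" for \<omega>
      using partition_on_restrict_part[OF partition[OF that], of n] by blast
  qed simp
  also have "\<dots> = (\<Sum>P\<in>?P. ?c * block_weight \<alpha> P)"
    using prob_restrict_order[OF order n _ ss(3)] ss s by (intro sum.cong refl) simp
  also have "\<dots> = common_factor * V (n + m) (j + k) / fact k *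
      ((\<Prod>x\<leftarrow>ss. pochhammer (1 - \<alpha>) (x - 1)) / (\<Prod>x\<leftarrow>ss. fact x))"
    unfolding total_weight_def sum_distrib_left[symmetric] by (simp add: mult_ac)
  finally show ?thesis unfolding prod_list_divide .
qed

text \<open>As no new block is empty, the possible size lists are exactly the compositions of
  \<open>s\<close> into \<open>k\<close> parts. Their sum is \<open>gen_stirling\<close> up to the
  factor \<open>fact s / fact k\<close>.\<close>

lemma prob_card_count_sum:
  "\<P>(\<omega> in M. card (restrict_part n (X \<omega>)) = j \<and> length (L \<omega>) = k \<and>
      sum_list (map card (L \<omega>)) = s)
    = common_factor * (V (n + m) (j + k) * gen_stirling \<alpha> s k) / fact s"
proof -
  have "\<P>(\<omega> in M. card (restrict_part n (X \<omega>)) = j \<and> length (L \<omega>) = k \<and>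
        sum_list (map card (L \<omega>)) = s)
      = (\<Sum>ss\<in>compositions s k.
          \<P>(\<omega> in M. card (restrict_part n (X \<omega>)) = j \<and> map card (L \<omega>) = ss))"
  proof (rule prob_eq_sum)
    show "{\<omega> \<in> space M. card (restrict_part n (X \<omega>)) = j \<and> length (L \<omega>) = k \<and>
        sum_list (map card (L \<omega>)) = s} \<in> events"
      by (rule sets_restrict_order[OF order])
    show "{\<omega> \<in> space M. card (restrict_part n (X \<omega>)) = j \<and> map card (L \<omega>) = ss} \<in> events" for ss
      by (rule sets_restrict_order[OF order])
    show "card (restrict_part n (X \<omega>)) = j \<and> length (L \<omega>) = k \<and> sum_list (map card (L \<omega>)) = s \<longleftrightarrow>
        (\<exists>ss\<in>compositions s k. card (restrict_part n (X \<omega>)) = j \<and> map card (L \<omega>) = ss)"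
      if "\<omega> \<in> space M" for \<omega>
    proof -
      have "\<forall>x\<in>set (map card (L \<omega>)). 1 \<le> x"
        using order_in_block_lists(2)[OF order that] by (metis One_nat_def Suc_leI not_gr0)
      then have "map card (L \<omega>) \<in> compositions s k \<longleftrightarrow>
          length (L \<omega>) = k \<and> sum_list (map card (L \<omega>)) = s"
        unfolding compositions_def by simp
      then show ?thesis by blast
    qed
  qed (auto simp: finite_compositions)
  also have "\<dots> = common_factor * V (n + m) (j + k) / fact k *
      (\<Sum>ss\<in>compositions s k. \<Prod>x\<leftarrow>ss. pochhammer (1 - \<alpha>) (x - 1) / fact x)"
    unfolding sum_distrib_left by (intro sum.cong refl prob_card_order)
  finally show ?thesis by (simp add: gen_stirling_def)
qed

text \<open>Each new block has at least one element, so there are at most \<open>s\<close> of them.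
  The term for 0 blocks matters when \<open>s = 0\<close>.\<close>

lemma prob_card_sum:
  "\<P>(\<omega> in M. card (restrict_part n (X \<omega>)) = j \<and> sum_list (map card (L \<omega>)) = s)
    = common_factor * (\<Sum>i=0..s. V (n + m) (j + i) * gen_stirling \<alpha> s i) / fact s"
proof -
  have "\<P>(\<omega> in M. card (restrict_part n (X \<omega>)) = j \<and> sum_list (map card (L \<omega>)) = s)
      = (\<Sum>i=0..s. \<P>(\<omega> in M. card (restrict_part n (X \<omega>)) = j \<and> length (L \<omega>) = i \<and>
          sum_list (map card (L \<omega>)) = s))"
  proof (rule prob_eq_sum)
    show "{\<omega> \<in> space M. card (restrict_part n (X \<omega>)) = j \<and> sum_list (map card (L \<omega>)) = s} \<in> events"
      by (rule sets_restrict_order[OF order])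
    show "{\<omega> \<in> space M. card (restrict_part n (X \<omega>)) = j \<and> length (L \<omega>) = i \<and>
        sum_list (map card (L \<omega>)) = s} \<in> events" for i
      by (rule sets_restrict_order[OF order])
    show "card (restrict_part n (X \<omega>)) = j \<and> sum_list (map card (L \<omega>)) = s \<longleftrightarrow>
        (\<exists>i\<in>{0..s}. card (restrict_part n (X \<omega>)) = j \<and> length (L \<omega>) = i \<and>
          sum_list (map card (L \<omega>)) = s)" if "\<omega> \<in> space M" for \<omega>
    proof -
      have "\<forall>x\<in>set (map card (L \<omega>)). 1 \<le> x"
        using order_in_block_lists(2)[OF order that] by (metis One_nat_def Suc_leI not_gr0)
      from length_le_sum_list[OF this] show ?thesis by auto
    qed
  qed auto
  also have "\<dots> = common_factor * (\<Sum>i=0..s. V (n + m) (j + i) * gen_stirling \<alpha> s i) / fact s"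
    unfolding prob_card_count_sum by (simp add: sum_distrib_left sum_divide_distrib)
  finally show ?thesis .
qed

end

end

section \<open>The three conditional laws\<close>

theorem proposition5:
  fixes M :: "'a measure" and \<alpha> :: real and V :: "nat \<Rightarrow> nat \<Rightarrow> real"
    and X :: "'a \<Rightarrow> nat set set" and L :: "'a \<Rightarrow> nat set list"
    and n m j k s :: nat and ss :: "nat list"
  assumes "gibbs_partition M \<alpha> V X"
    and "1 \<le> n" and "1 \<le> m"
    and "exchangeable_order M X n m L"
    and "1 \<le> k" and "k \<le> s" and "s \<le> m"
    and "ss \<in> compositions s k"
  shows
    "(\<forall>P. partition_on {1..n} P \<longrightarrow> card P = j \<longrightarrow> 0 < V n j \<longrightarrow>
        \<P>(\<omega> in M. card (new_blocks n m (X \<omega>)) = k \<and> sum_list (map card (L \<omega>)) = s \<and>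
              map card (L \<omega>) = ss \<bar> restrict_part n (X \<omega>) = P)
          = fact s / ((\<Prod>x\<leftarrow>ss. fact x) * fact k) * (V (n + m) (j + k) / V n j)
              * real (m choose s) * pochhammer (real n - real j * \<alpha>) (m - s)
              * (\<Prod>x\<leftarrow>ss. pochhammer (1 - \<alpha>) (x - 1)) \<and>
        fact s / ((\<Prod>x\<leftarrow>ss. fact x) * fact k) * (V (n + m) (j + k) / V n j)
              * real (m choose s) * pochhammer (real n - real j * \<alpha>) (m - s)
              * (\<Prod>x\<leftarrow>ss. pochhammer (1 - \<alpha>) (x - 1))
          = fact m / ((\<Prod>x\<leftarrow>ss. fact x) * fact k * fact (m - s)) * (V (n + m) (j + k) / V n j)
              * pochhammer (real n - real j * \<alpha>) (m - s)
              * (\<Prod>x\<leftarrow>ss. pochhammer (1 - \<alpha>) (x - 1)))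
     \<and>
     (0 < \<P>(\<omega> in M. card (restrict_part n (X \<omega>)) = j \<and> sum_list (map card (L \<omega>)) = s) \<longrightarrow>
        \<P>(\<omega> in M. card (new_blocks n m (X \<omega>)) = k \<and> map card (L \<omega>) = ss
              \<bar> card (restrict_part n (X \<omega>)) = j \<and> sum_list (map card (L \<omega>)) = s)
          = fact s / ((\<Prod>x\<leftarrow>ss. fact x) * fact k)
              * (V (n + m) (j + k) / (\<Sum>i=0..s. V (n + m) (j + i) * gen_stirling \<alpha> s i))
              * (\<Prod>x\<leftarrow>ss. pochhammer (1 - \<alpha>) (x - 1)))
     \<and>
     (0 < \<P>(\<omega> in M. card (new_blocks n m (X \<omega>)) = k \<and> sum_list (map card (L \<omega>)) = s \<and>
              card (restrict_part n (X \<omega>)) = j) \<longrightarrow>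
        \<P>(\<omega> in M. map card (L \<omega>) = ss
              \<bar> card (new_blocks n m (X \<omega>)) = k \<and> sum_list (map card (L \<omega>)) = s \<and>
                card (restrict_part n (X \<omega>)) = j)
          = fact s / ((\<Prod>x\<leftarrow>ss. fact x) * fact k)
              * ((\<Prod>x\<leftarrow>ss. pochhammer (1 - \<alpha>) (x - 1)) / gen_stirling \<alpha> s k))"
    (is "(\<forall>P. ?part P \<longrightarrow> ?card P \<longrightarrow> 0 < V n j \<longrightarrow> ?cond1 P = ?f \<and> ?f = ?g) \<and>
      (0 < ?den2 \<longrightarrow> ?cond2 = ?r2) \<and> (0 < ?den3 \<longrightarrow> ?cond3 = ?r3)")
proof -
  interpret gibbs_partition M \<alpha> V X by fact
  note order = assms(4)
  have ss: "length ss = k" "sum_list ss = s" "0 \<notin> set ss"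
    using assms(8) by (auto simp: compositions_def)
  have K: "card (new_blocks n m (X \<omega>)) = length (L \<omega>)" if "\<omega> \<in> space M" for \<omega>
    using card_new_blocks_order[OF order that] .
  \<comment> \<open>The list of sizes determines the number of new blocks and their total size, so
    these conditions drop out of all three numerators.\<close>
  have sizes: "length l = k" "sum_list (map card l) = s" if "map card l = ss" for l :: "nat set list"
    using that ss by auto
  let ?W = "fact m / fact (m - s) * pochhammer (real n - real j * \<alpha>) (m - s) * total_weight \<alpha> n j"
  let ?w = "\<Prod>x\<leftarrow>ss. pochhammer (1 - \<alpha>) (x - 1)" and ?F = "\<Prod>x\<leftarrow>ss. fact x :: real"
  let ?E = "\<P>(\<omega> in M. card (restrict_part n (X \<omega>)) = j \<and> map card (L \<omega>) = ss)"
  have E: "?E = ?W * V (n + m) (j + k) / fact k * (?w / ?F)"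
    using prob_card_order[OF order assms(2,7,8)] by (simp add: prod_list_divide)
  have fg: "?f = ?g"
    using assms(7) by (simp add: binomial_fact mult_ac)
  have "?cond1 P = ?f" if P: "?part P" "?card P" "0 < V n j" for P
  proof -
    have "?cond1 P = \<P>(\<omega> in M. restrict_part n (X \<omega>) = P \<and> map card (L \<omega>) = ss)
        / \<P>(\<omega> in M. restrict_part n (X \<omega>) = P)"
      unfolding cond_prob_def
      using K sizes by (intro arg_cong2[where f = "(/)"] arg_cong[where f = prob] refl) auto
    \<comment> \<open>The weight of \<open>P\<close> occurs in numerator and denominator and cancels
      because it is positive; \<open>V n j\<close> remains in the denominator.\<close>
    also have "\<dots> = ?g"
      using prob_restrict_order[OF order assms(2) P(1) ss(3)] ss assms(7)
        prob_restrict_part_eq[OF assms(2) P(1)] P block_weight_pos[OF alpha_less_1, of P]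
      by (simp add: mult_ac)
    finally show ?thesis using fg by simp
  qed
  moreover have "?cond2 = ?r2" if "0 < ?den2"
  proof -
    have "?cond2 = ?E / ?den2"
      unfolding cond_prob_def
      using K sizes by (intro arg_cong2[where f = "(/)"] arg_cong[where f = prob] refl) auto
    also have "\<dots> = ?r2"
    proof -
      let ?S = "\<Sum>i=0..s. V (n + m) (j + i) * gen_stirling \<alpha> s i"
      have D: "?den2 = ?W * ?S / fact s"
        by (rule prob_card_sum[OF order assms(2,7)])
      \<comment> \<open>\<open>?W\<close> vanishes if no partition of \<open>{1..n}\<close> has
        \<open>j\<close> blocks. Positivity of the conditioning event excludes this and lets
        \<open>?W\<close> cancel.\<close>
      then have "?W \<noteq> 0" using that by auto
      then show ?thesis unfolding E D
        by (simp add: mult_ac del: mult_eq_0_iff)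
    qed
    finally show ?thesis .
  qed
  moreover have "?cond3 = ?r3" if "0 < ?den3"
  proof -
    have "?cond3 = ?E / ?den3"
      unfolding cond_prob_def
      using K sizes by (intro arg_cong2[where f = "(/)"] arg_cong[where f = prob] refl) auto
    also have "\<dots> = ?r3"
    proof -
      have "?den3 = \<P>(\<omega> in M. card (restrict_part n (X \<omega>)) = j \<and> length (L \<omega>) = k \<and>
          sum_list (map card (L \<omega>)) = s)"
        using K by (intro arg_cong[where f = prob]) auto
      then have D: "?den3 = ?W * (V (n + m) (j + k) * gen_stirling \<alpha> s k) / fact s"
        using prob_card_count_sum[OF order assms(2,7)] by simp
      \<comment> \<open>With the number of new blocks fixed, \<open>V (n + m) (j + k)\<close> is a
        common factor as well, so it has to be nonzero too.\<close>
      then have "?W \<noteq> 0" "V (n + m) (j + k) \<noteq> 0" using that by auto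
      then show ?thesis unfolding E D
        by (simp add: mult_ac del: mult_eq_0_iff)
    qed
    finally show ?thesis .
  qed
  ultimately show ?thesis using fg by blast
qed

end
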